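(* Consider reliance profiles in the continuous idealization $n\to\infty$ (proportions may be arbitrary reals). Let the AI accuracy $Acc_{AI}\in(50\%,100\%]$ and the degree of adherence $\mathcal{A}\in[0\%,100\%]$ be given. Then the set of values of the final decision-making accuracy $Acc_{final}$ attained by reliance profiles with AI accuracy $Acc_{AI}$ and degree of adherence $\mathcal{A}$ is exactly the closed interval \[ \begin{cases} [\,100\%-Acc_{AI}-\mathcal{A},\ 100\%-Acc_{AI}+\mathcal{A}\,] & \text{if } 0\le \mathcal{A}\le 100\%-Acc_{AI},\\ [\,-100\%+Acc_{AI}+\mathcal{A},\ 100\%-Acc_{AI}+\mathcal{A}\,] & \text{if } 100\%-Acc_{AI}<\mathcal{A}\le Acc_{AI},\\ [\,-100\%+Acc_{AI}+\mathcal{A},\ 100\%+Acc_{AI}-\mathcal{A}\,] & \text{if } Acc_{AI}<\mathcal{A}\le 100\%. \end{cases} \]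
   Context: Percentages are real numbers with $100\%=1$. A binary decision task has $n$ AI recommendations, each correct or wrong; a human either adheres to or overrides each one. A reliance profile is a quadruple of nonnegative real proportions $(\mathcal{A}_{correct},\mathcal{A}_{wrong},\mathcal{O}_{correct},\mathcal{O}_{wrong})$ with $\mathcal{A}_{correct}+\mathcal{A}_{wrong}+\mathcal{O}_{correct}+\mathcal{O}_{wrong}=100\%$, where $\mathcal{A}_{correct}$ is the share of recommendations that are correct and adhered to, $\mathcal{A}_{wrong}$ wrong and adhered to, $\mathcal{O}_{correct}$ wrong and overridden, $\mathcal{O}_{wrong}$ correct and overridden. The convention $n\to\infty$ means these proportions may be any real numbers subject to these constraints (no rounding). For a profile, define the degree of adherence $\mathcal{A}=\mathcal{A}_{correct}+\mathcal{A}_{wrong}$, the degree of overriding $\mathcal{O}=\mathcal{O}_{correct}+\mathcal{O}_{wrong}$, the AI accuracy $Acc_{AI}=\mathcal{A}_{correct}+\mathcal{O}_{wrong}$, and the final decision-making accuracy $Acc_{final}=\mathcal{A}_{correct}+\mathcal{O}_{correct}$. *)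

theory Defs
  imports Complex_Main
begin

(* Percentages are real numbers with 100% = 1.  The proportions are arbitrary reals, not
   multiples of 1/n: this is the continuous idealization n -> infinity. *)

record reliance =
  A_correct :: real  (* AI correct, adhered to *)
  A_wrong   :: real  (* AI wrong, adhered to *)
  O_correct :: real  (* AI wrong, overridden *)
  O_wrong   :: real  (* AI correct, overridden *)

definition reliance_profile :: "reliance \<Rightarrow> bool" where
  "reliance_profile r \<longleftrightarrow>
     0 \<le> A_correct r \<and> 0 \<le> A_wrong r \<and> 0 \<le> O_correct r \<and> 0 \<le> O_wrong r \<and>
     A_correct r + A_wrong r + O_correct r + O_wrong r = 1"

definition adherence :: "reliance \<Rightarrow> real" where
  "adherence r = A_correct r + A_wrong r"

definition overriding :: "reliance \<Rightarrow> real" where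
  "overriding r = O_correct r + O_wrong r"

definition acc_AI :: "reliance \<Rightarrow> real" where
  "acc_AI r = A_correct r + O_wrong r"

definition acc_final :: "reliance \<Rightarrow> real" where
  "acc_final r = A_correct r + O_correct r"

end

theory Submission
  imports Defs
begin

text \<open>With the accuracy \<open>p\<close> of the AI and the adherence \<open>a\<close> fixed, one degree of freedom
  \<open>c = A_correct\<close> remains. The other entries are \<open>a - c\<close>, \<open>1 - a - p + c\<close> and \<open>p - c\<close>, so the
  final accuracy is the affine function \<open>1 - a - p + 2 * c\<close> of \<open>c\<close>, and nonnegativity confines
  \<open>c\<close> to the interval from \<open>max 0 (a + p - 1)\<close> to \<open>min a p\<close>.\<close>

lemma acc_final_attained_iff:
  "(\<exists>r. reliance_profile r \<and> acc_AI r = p \<and> adherence r = a \<and> acc_final r = f) \<longleftrightarrow>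
     \<bar>1 - p - a\<bar> \<le> f \<and> f \<le> 1 - \<bar>p - a\<bar>"
proof
  assume "\<exists>r. reliance_profile r \<and> acc_AI r = p \<and> adherence r = a \<and> acc_final r = f"
  then show "\<bar>1 - p - a\<bar> \<le> f \<and> f \<le> 1 - \<bar>p - a\<bar>"
    by (auto simp: reliance_profile_def acc_AI_def adherence_def acc_final_def)
next
  assume bounds: "\<bar>1 - p - a\<bar> \<le> f \<and> f \<le> 1 - \<bar>p - a\<bar>"
  \<comment> \<open>This is \<open>f = 1 - a - p + 2 * c\<close> solved for
    \<open>c\<close>.\<close>
  define c where "c = (f + a + p - 1) / 2"
  let ?r = "\<lparr>A_correct = c, A_wrong = a - c, O_correct = 1 - a - p + c, O_wrong = p - c\<rparr>"
  \<comment> \<open>Nonnegativity of the four entries amounts, in order, to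
    \<open>1 - a - p \<le> f\<close>, \<open>f \<le> 1 + a - p\<close>,
    \<open>a + p - 1 \<le> f\<close> and \<open>f \<le> 1 + p - a\<close>: the two absolute values
    unfolded.\<close>
  have "reliance_profile ?r \<and> acc_AI ?r = p \<and> adherence ?r = a \<and> acc_final ?r = f"
    using bounds
    by (auto simp: c_def reliance_profile_def acc_AI_def adherence_def acc_final_def
        abs_le_iff field_simps)
  then show "\<exists>r. reliance_profile r \<and> acc_AI r = p \<and> adherence r = a \<and> acc_final r = f"
    by blast
qed

theorem proposition1:
  fixes Acc\<^sub>A\<^sub>I \<A> :: real
  assumes "1/2 < Acc\<^sub>A\<^sub>I" and "Acc\<^sub>A\<^sub>I \<le> 1"
    and "0 \<le> \<A>" and "\<A> \<le> 1"
  shows "{acc_final r | r. reliance_profile r \<and> acc_AI r = Acc\<^sub>A\<^sub>I \<and> adherence r = \<A>} =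
    (if \<A> \<le> 1 - Acc\<^sub>A\<^sub>I then {1 - Acc\<^sub>A\<^sub>I - \<A> .. 1 - Acc\<^sub>A\<^sub>I + \<A>}
     else if \<A> \<le> Acc\<^sub>A\<^sub>I then {- 1 + Acc\<^sub>A\<^sub>I + \<A> .. 1 - Acc\<^sub>A\<^sub>I + \<A>}
     else {- 1 + Acc\<^sub>A\<^sub>I + \<A> .. 1 + Acc\<^sub>A\<^sub>I - \<A>})"
proof -
  have "{acc_final r | r. reliance_profile r \<and> acc_AI r = Acc\<^sub>A\<^sub>I \<and> adherence r = \<A>} =
      {\<bar>1 - Acc\<^sub>A\<^sub>I - \<A>\<bar> .. 1 - \<bar>Acc\<^sub>A\<^sub>I - \<A>\<bar>}"
    using acc_final_attained_iff[of Acc\<^sub>A\<^sub>I \<A>] by (auto simp: set_eq_iff) metis+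
  \<comment> \<open>The cases fix the signs inside both absolute values:
    \<open>1/2 < Acc\<^sub>A\<^sub>I\<close> puts the breakpoint
    \<open>1 - Acc\<^sub>A\<^sub>I\<close> below \<open>Acc\<^sub>A\<^sub>I\<close>.\<close>
  then show ?thesis
    using assms(1) by (auto simp: abs_if)
qed

end
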